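(* Let $P$ be a preframe, and let $\Gamma$ be a set of prenuclei on $P$; then the closure operator $\overline{\Gamma}$ generated by the set $\Gamma$ of preclosure maps is a nucleus. In particular, if $\Gamma$ is a set of nuclei on $P$, then the join $\bigvee\Gamma$, taken in the complete lattice $\mathrm{Cl}(P)$ of all closure operators on $P$, is a nucleus.
   Context: A dcpo is a poset in which every directed (in particular nonempty) subset has a join. A preframe is a dcpo $P$ that is also a meet-semilattice (every two elements have a meet; a top element is not required) and in which $x\wedge\bigvee Y=\bigvee_{y\in Y}(x\wedge y)$ for every $x\in P$ and every directed $Y\subseteq P$. A preclosure map on $P$ is a map $f:P\to P$ that is increasing and ascending ($x\le f(x)$ for all $x$); a closure operator is an idempotent preclosure map. A prenucleus on a meet-semilattice is a preclosure map that preserves binary meets; a nucleus is a closure operator that preserves binary meets. $\mathrm{Cl}(P)$ is the set of all closure operators on $P$ ordered pointwise; for a dcpo $P$ it is a complete lattice. For a set $G$ of preclosure maps on a dcpo $P$, the closure operator $\overline{G}$ generated by $G$ is the closure operator with $\mathrm{fix}(\overline{G})=\{x\in P: g(x)=x\text{ for all }g\in G\}$; it is the least closure operator $h$ on $P$ with $h\ge g$ for all $g\in G$. *)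

theory Defs
  imports "HOL-Algebra.Complete_Lattice"
begin

definition directed :: "('a, 'b) gorder_scheme \<Rightarrow> 'a set \<Rightarrow> bool" where
  "directed L D \<longleftrightarrow>
     D \<subseteq> carrier L \<and> D \<noteq> {} \<and> (\<forall>x\<in>D. \<forall>y\<in>D. \<exists>z\<in>D. x \<sqsubseteq>\<^bsub>L\<^esub> z \<and> y \<sqsubseteq>\<^bsub>L\<^esub> z)"

locale dcpo = partial_order L for L (structure) +
  assumes directed_sup_exists: "directed L D \<Longrightarrow> \<exists>s. least L s (Upper L D)"

locale preframe = dcpo L + lower_semilattice L for L (structure) +
  assumes inf_directed_sup:
    "\<lbrakk>x \<in> carrier L; directed L Y\<rbrakk> \<Longrightarrow> x \<sqinter> (\<Squnion>Y) = \<Squnion>((\<lambda>y. x \<sqinter> y) ` Y)"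

text \<open>A self-map of a poset is represented by an extensional function on the carrier, so
  that two maps agreeing on the carrier are equal and the pointwise order below is
  antisymmetric.\<close>

definition preclosure_map :: "('a, 'b) gorder_scheme \<Rightarrow> ('a \<Rightarrow> 'a) \<Rightarrow> bool" where
  "preclosure_map L f \<longleftrightarrow>
     f \<in> carrier L \<rightarrow>\<^sub>E carrier L \<and> Mono\<^bsub>L\<^esub> f \<and> (\<forall>x\<in>carrier L. x \<sqsubseteq>\<^bsub>L\<^esub> f x)"

definition closure_operator :: "('a, 'b) gorder_scheme \<Rightarrow> ('a \<Rightarrow> 'a) \<Rightarrow> bool" where
  "closure_operator L f \<longleftrightarrow> preclosure_map L f \<and> Idem\<^bsub>L\<^esub> f"

text \<open>The library's \<open>meet_pres\<close> demands that both structures be lattices, so it is not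
  usable for meet-semilattices.\<close>

definition preserves_meets :: "('a, 'b) gorder_scheme \<Rightarrow> ('a \<Rightarrow> 'a) \<Rightarrow> bool" where
  "preserves_meets L f \<longleftrightarrow>
     (\<forall>x\<in>carrier L. \<forall>y\<in>carrier L. f (x \<sqinter>\<^bsub>L\<^esub> y) = f x \<sqinter>\<^bsub>L\<^esub> f y)"

definition prenucleus :: "('a, 'b) gorder_scheme \<Rightarrow> ('a \<Rightarrow> 'a) \<Rightarrow> bool" where
  "prenucleus L f \<longleftrightarrow> preclosure_map L f \<and> preserves_meets L f"

definition nucleus :: "('a, 'b) gorder_scheme \<Rightarrow> ('a \<Rightarrow> 'a) \<Rightarrow> bool" where
  "nucleus L f \<longleftrightarrow> closure_operator L f \<and> preserves_meets L f"

definition Cl :: "('a, 'b) gorder_scheme \<Rightarrow> ('a \<Rightarrow> 'a) gorder" where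
  "Cl L = \<lparr>carrier = {f. closure_operator L f}, eq = (=),
           le = (\<lambda>f g. \<forall>x\<in>carrier L. f x \<sqsubseteq>\<^bsub>L\<^esub> g x)\<rparr>"

definition generated_closure ::
    "('a, 'b) gorder_scheme \<Rightarrow> ('a \<Rightarrow> 'a) set \<Rightarrow> 'a \<Rightarrow> 'a" where
  "generated_closure L G =
     (THE h. closure_operator L h \<and> fps L h = {x \<in> carrier L. \<forall>g\<in>G. g x = x})"


text \<open>Well-definedness: on a dcpo, the description in \<open>generated_closure\<close> determines exactly
  one map, this map is the least closure operator above \<open>G\<close>, and \<open>Cl L\<close> is a complete
  lattice.\<close>

lemma (in dcpo) directed_sup_least: "directed L D \<Longrightarrow> least L (\<Squnion>D) (Upper L D)"
  unfolding sup_def using directed_sup_exists by (rule someI_ex)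

lemma (in partial_order) preclosure_mapI:
  assumes "f \<in> carrier L \<rightarrow>\<^sub>E carrier L"
    "\<And>x y. \<lbrakk>x \<in> carrier L; y \<in> carrier L; x \<sqsubseteq> y\<rbrakk> \<Longrightarrow> f x \<sqsubseteq> f y"
    "\<And>x. x \<in> carrier L \<Longrightarrow> x \<sqsubseteq> f x"
  shows "preclosure_map L f"
  using assms weak_partial_order_axioms unfolding preclosure_map_def isotone_def by auto

lemma preclosure_mapD:
  assumes "preclosure_map L f"
  shows "f \<in> carrier L \<rightarrow>\<^sub>E carrier L"
    and "x \<in> carrier L \<Longrightarrow> f x \<in> carrier L"
    and "\<lbrakk>x \<in> carrier L; y \<in> carrier L; x \<sqsubseteq>\<^bsub>L\<^esub> y\<rbrakk> \<Longrightarrow> f x \<sqsubseteq>\<^bsub>L\<^esub> f y"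
    and "x \<in> carrier L \<Longrightarrow> x \<sqsubseteq>\<^bsub>L\<^esub> f x"
  using assms unfolding preclosure_map_def isotone_def by auto

lemma (in partial_order) fps_eq: "fps L f = {x \<in> carrier L. f x = x}"
  unfolding fps_def eq_is_equal ..

lemma (in partial_order) closure_operator_iff:
  "closure_operator L f \<longleftrightarrow> preclosure_map L f \<and> (\<forall>x\<in>carrier L. f (f x) = f x)"
  unfolding closure_operator_def idempotent_def eq_is_equal ..

lemma (in partial_order) closure_le_if_fps_subset:
  assumes "closure_operator L c" "closure_operator L d" "fps L c \<subseteq> fps L d"
    and x: "x \<in> carrier L"
  shows "d x \<sqsubseteq> c x"
proof -
  have c: "preclosure_map L c" "\<forall>x\<in>carrier L. c (c x) = c x" and d: "preclosure_map L d"
    using assms closure_operator_iff by auto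
  have cx: "c x \<in> carrier L" using c x by (auto dest: preclosure_mapD)
  then have "d (c x) = c x" using assms(3) c x by (auto simp: fps_eq)
  moreover have "d x \<sqsubseteq> d (c x)"
    using c d x cx by (auto intro!: preclosure_mapD(3)[OF d] dest: preclosure_mapD(4))
  ultimately show ?thesis by simp
qed

lemma (in partial_order) closure_eq_if_fps_eq:
  assumes "closure_operator L c" "closure_operator L d" "fps L c = fps L d"
  shows "c = d"
proof (rule PiE_ext)
  show c: "c \<in> carrier L \<rightarrow>\<^sub>E carrier L" and d: "d \<in> carrier L \<rightarrow>\<^sub>E carrier L"
    using assms closure_operator_iff by (auto dest: preclosure_mapD(1))
  fix x assume x: "x \<in> carrier L"
  then have "d x \<sqsubseteq> c x" "c x \<sqsubseteq> d x"
    using closure_le_if_fps_subset assms by auto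
  then show "c x = d x" using c d x le_antisym by auto
qed

lemma (in dcpo) generated_closure_exists:
  assumes G: "\<forall>g\<in>G. preclosure_map L g"
  shows "\<exists>h. closure_operator L h \<and> fps L h = {x \<in> carrier L. \<forall>g\<in>G. g x = x}"
proof -
  define F where "F = {x \<in> carrier L. \<forall>g\<in>G. g x = x}"
  define C where "C = {k. preclosure_map L k \<and> (\<forall>z\<in>F. k z = z)}"
  define m where "m = (\<lambda>x\<in>carrier L. \<Squnion>((\<lambda>k. k x) ` C))"
  have CP: "preclosure_map L k" if "k \<in> C" for k using that by (simp add: C_def)
  have GC: "G \<subseteq> C" using G by (auto simp: C_def F_def)
  have idC: "(\<lambda>x\<in>carrier L. x) \<in> C"
    by (auto simp: C_def F_def intro!: preclosure_mapI)
  have comp: "compose (carrier L) k l \<in> C" if kl: "k \<in> C" "l \<in> C" for k l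
  proof -
    note k = preclosure_mapD[OF CP[OF kl(1)]] and l = preclosure_mapD[OF CP[OF kl(2)]]
    have "preclosure_map L (compose (carrier L) k l)"
    proof (rule preclosure_mapI)
      show "compose (carrier L) k l \<in> carrier L \<rightarrow>\<^sub>E carrier L"
        using k(2) l(2) by (auto simp: compose_def)
      show "compose (carrier L) k l x \<sqsubseteq> compose (carrier L) k l y"
        if "x \<in> carrier L" "y \<in> carrier L" "x \<sqsubseteq> y" for x y
        using that k l by (simp add: compose_eq)
      show "x \<sqsubseteq> compose (carrier L) k l x" if "x \<in> carrier L" for x
        using that k(2,4) l(2,4) by (auto simp: compose_eq intro: le_trans[of x "l x"])
    qed
    then show ?thesis using kl by (auto simp: C_def F_def compose_eq)
  qed
  have dir: "directed L ((\<lambda>k. k x) ` C)" if x: "x \<in> carrier L" for x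
    unfolding directed_def
  proof (intro conjI ballI)
    show "(\<lambda>k. k x) ` C \<subseteq> carrier L" using preclosure_mapD(2)[OF CP x] by blast
    show "(\<lambda>k. k x) ` C \<noteq> {}" using idC by blast
  next
    fix a b assume "a \<in> (\<lambda>k. k x) ` C" "b \<in> (\<lambda>k. k x) ` C"
    then obtain k l where kl: "k \<in> C" "l \<in> C" "a = k x" "b = l x" by auto
    note k = preclosure_mapD[OF CP[OF kl(1)]] and l = preclosure_mapD[OF CP[OF kl(2)]]
    have "a \<sqsubseteq> compose (carrier L) k l x" "b \<sqsubseteq> compose (carrier L) k l x"
      using kl x k l by (auto simp: compose_eq)
    then show "\<exists>z\<in>(\<lambda>k. k x) ` C. a \<sqsubseteq> z \<and> b \<sqsubseteq> z" using comp[OF kl(1,2)] by blast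
  qed
  have lst: "least L (m x) (Upper L ((\<lambda>k. k x) ` C))" if "x \<in> carrier L" for x
    using directed_sup_least[OF dir[OF that]] that by (simp add: m_def)
  have mcar: "m x \<in> carrier L" if "x \<in> carrier L" for x
    using lst[OF that] by (auto simp: least_def Upper_def)
  have mub: "k x \<sqsubseteq> m x" if "x \<in> carrier L" "k \<in> C" for k x
    using least_Upper_above[OF lst[OF that(1)]] dir[OF that(1)] that
    by (auto simp: directed_def)
  have mlub: "m x \<sqsubseteq> u"
    if "x \<in> carrier L" "u \<in> carrier L" "\<And>k. k \<in> C \<Longrightarrow> k x \<sqsubseteq> u" for x u
    using lst[OF that(1)] that dir[OF that(1)]
    by (auto simp: least_def Upper_def)
  have asc: "x \<sqsubseteq> m x" if "x \<in> carrier L" for x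
    using mub[OF that idC] that by simp
  have mpre: "preclosure_map L m"
  proof (rule preclosure_mapI)
    show "m \<in> carrier L \<rightarrow>\<^sub>E carrier L" using mcar by (auto simp: m_def)
    show "m x \<sqsubseteq> m y" if xy: "x \<in> carrier L" "y \<in> carrier L" "x \<sqsubseteq> y" for x y
    proof (rule mlub)
      fix k assume k: "k \<in> C"
      note kp = preclosure_mapD[OF CP[OF k]]
      show "k x \<sqsubseteq> m y"
        using le_trans[OF kp(3)[OF xy] mub[OF xy(2) k]] kp(2)[OF xy(1)] mcar[OF xy(2)] kp(2)[OF xy(2)] by blast
    qed (use xy mcar in auto)
  qed (use asc in auto)
  have mF: "m z = z" if z: "z \<in> F" for z
  proof -
    have zc: "z \<in> carrier L" using z by (simp add: F_def)
    have "m z \<sqsubseteq> z" by (rule mlub) (use z zc in \<open>auto simp: C_def\<close>)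
    then show ?thesis using asc[OF zc] zc mcar[OF zc] by (intro le_antisym)
  qed
  have mC: "m \<in> C" using mpre mF by (simp add: C_def)
  have fixed: "k (m x) = m x" if "k \<in> C" "x \<in> carrier L" for k x
  proof -
    have "k (m x) \<sqsubseteq> m x" using mub[OF that(2) comp[OF that(1) mC]] that by (simp add: compose_eq)
    moreover note kp = preclosure_mapD[OF CP[OF that(1)]]
    ultimately show ?thesis
      using kp(2)[OF mcar] kp(4)[OF mcar] mcar that(2) by (intro le_antisym) auto
  qed
  have "closure_operator L m" using mpre fixed mC by (auto simp: closure_operator_iff)
  moreover have "fps L m = F"
  proof
    show "F \<subseteq> fps L m" using mF by (auto simp: fps_eq F_def)
    show "fps L m \<subseteq> F"
    proof
      fix x assume "x \<in> fps L m"
      then have x: "x \<in> carrier L" "m x = x" by (auto simp: fps_eq)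
      then have "g x = x" if "g \<in> G" for g using fixed[of g x] GC that by auto
      then show "x \<in> F" using x by (simp add: F_def)
    qed
  qed
  ultimately show ?thesis by (auto simp: F_def)
qed

lemma (in dcpo) generated_closure:
  assumes "\<forall>g\<in>G. preclosure_map L g"
  shows "closure_operator L (generated_closure L G)"
    and "fps L (generated_closure L G) = {x \<in> carrier L. \<forall>g\<in>G. g x = x}"
proof -
  have "\<exists>!h. closure_operator L h \<and> fps L h = {x \<in> carrier L. \<forall>g\<in>G. g x = x}"
    using generated_closure_exists[OF assms] closure_eq_if_fps_eq by (metis (no_types, lifting))
  from theI'[OF this]
  show "closure_operator L (generated_closure L G)"
    and "fps L (generated_closure L G) = {x \<in> carrier L. \<forall>g\<in>G. g x = x}"
    by (auto simp: generated_closure_def)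
qed

lemma (in dcpo) generated_closure_upper:
  assumes G: "\<forall>g\<in>G. preclosure_map L g" and g: "g \<in> G" and x: "x \<in> carrier L"
  shows "g x \<sqsubseteq> generated_closure L G x"
proof -
  let ?h = "generated_closure L G"
  have h: "preclosure_map L ?h" "?h (?h x) = ?h x"
    using generated_closure(1)[OF G] x by (auto simp: closure_operator_iff)
  have hx: "?h x \<in> carrier L" using preclosure_mapD(2)[OF h(1) x] .
  then have "?h x \<in> fps L ?h" using h by (simp add: fps_eq)
  then have "g (?h x) = ?h x" using generated_closure(2)[OF G] g by auto
  then show ?thesis
    using preclosure_mapD(3)[OF bspec[OF G g] x hx preclosure_mapD(4)[OF h(1) x]] by simp
qed

lemma (in dcpo) generated_closure_least:
  assumes G: "\<forall>g\<in>G. preclosure_map L g"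
    and h: "closure_operator L h" "\<And>g x. \<lbrakk>g \<in> G; x \<in> carrier L\<rbrakk> \<Longrightarrow> g x \<sqsubseteq> h x"
    and x: "x \<in> carrier L"
  shows "generated_closure L G x \<sqsubseteq> h x"
proof (rule closure_le_if_fps_subset[OF h(1) generated_closure(1)[OF G] _ x])
  show "fps L h \<subseteq> fps L (generated_closure L G)"
    unfolding generated_closure(2)[OF G]
  proof (clarsimp simp: fps_eq)
    fix z g assume z: "z \<in> carrier L" "h z = z" "g \<in> G"
    then have "g z \<sqsubseteq> z" using h(2)[of g z] by simp
    moreover have "preclosure_map L g" using G z by blast
    note gp = preclosure_mapD(2,4)[OF this z(1)]
    ultimately show "g z = z" using gp z(1) by (intro le_antisym)
  qed
qed

lemma (in partial_order) Cl_partial_order: "partial_order (Cl L)"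
proof (unfold_locales)
  fix f g assume fg: "f \<in> carrier (Cl L)" "g \<in> carrier (Cl L)"
    "f \<sqsubseteq>\<^bsub>Cl L\<^esub> g" "g \<sqsubseteq>\<^bsub>Cl L\<^esub> f"
  have f: "f \<in> carrier L \<rightarrow>\<^sub>E carrier L" and g: "g \<in> carrier L \<rightarrow>\<^sub>E carrier L"
    using fg by (auto simp: Cl_def closure_operator_iff dest: preclosure_mapD(1))
  have "f = g"
    by (rule PiE_ext[OF f g], rule le_antisym) (use fg f g in \<open>auto simp: Cl_def\<close>)
  then show "f .=\<^bsub>Cl L\<^esub> g" by (simp add: Cl_def)
next
  fix f g h assume "f \<in> carrier (Cl L)" "g \<in> carrier (Cl L)" "h \<in> carrier (Cl L)"
    "f \<sqsubseteq>\<^bsub>Cl L\<^esub> g" "g \<sqsubseteq>\<^bsub>Cl L\<^esub> h"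
  moreover from this have "\<And>x. x \<in> carrier L \<Longrightarrow>
      f x \<in> carrier L \<and> g x \<in> carrier L \<and> h x \<in> carrier L"
    by (auto simp: Cl_def closure_operator_iff dest: preclosure_mapD(2))
  ultimately show "f \<sqsubseteq>\<^bsub>Cl L\<^esub> h"
    by (auto simp: Cl_def intro: le_trans)
qed (auto simp: Cl_def closure_operator_iff dest: preclosure_mapD(2))

lemma (in dcpo) Cl_least_Upper:
  assumes "G \<subseteq> carrier (Cl L)"
  shows "least (Cl L) (generated_closure L G) (Upper (Cl L) G)"
proof -
  have G: "\<forall>g\<in>G. preclosure_map L g"
    using assms by (auto simp: Cl_def closure_operator_iff)
  have "generated_closure L G \<in> Upper (Cl L) G"
    using generated_closure(1)[OF G] generated_closure_upper[OF G]
    by (auto simp: Upper_def Cl_def)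
  moreover have "generated_closure L G \<sqsubseteq>\<^bsub>Cl L\<^esub> h" if h: "h \<in> Upper (Cl L) G" for h
  proof -
    have hc: "closure_operator L h" and hG: "\<And>g x. \<lbrakk>g \<in> G; x \<in> carrier L\<rbrakk> \<Longrightarrow> g x \<sqsubseteq> h x"
      using h assms by (auto simp: Upper_def Cl_def)
    have "generated_closure L G x \<sqsubseteq> h x" if "x \<in> carrier L" for x
      by (rule generated_closure_least[OF G hc _ that]) (rule hG)
    then show ?thesis by (simp add: Cl_def)
  qed
  ultimately show ?thesis by (auto simp: least_def Upper_def)
qed

lemma (in dcpo) Cl_complete_lattice: "complete_lattice (Cl L)"
proof -
  interpret Cl: partial_order "Cl L" by (rule Cl_partial_order)
  have sup: "\<exists>s. least (Cl L) s (Upper (Cl L) A)" if "A \<subseteq> carrier (Cl L)" for A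
    using Cl_least_Upper that by blast
  show ?thesis
  proof (rule Cl.complete_latticeI)
    show "\<exists>s. least (Cl L) s (Upper (Cl L) A)" if "A \<subseteq> carrier (Cl L)" for A
      using sup that .
    show "\<exists>i. greatest (Cl L) i (Lower (Cl L) A)" if A: "A \<subseteq> carrier (Cl L)" for A
    proof -
      obtain s where s: "least (Cl L) s (Upper (Cl L) (Lower (Cl L) A))"
        using sup[of "Lower (Cl L) A"] by auto
      have "s \<sqsubseteq>\<^bsub>Cl L\<^esub> a" if "a \<in> A" for a
        using s A that by (auto simp: least_def Upper_def Lower_def)
      then have "s \<in> Lower (Cl L) A"
        using s by (auto simp: least_def Upper_def Lower_def)
      moreover have "y \<sqsubseteq>\<^bsub>Cl L\<^esub> s" if "y \<in> Lower (Cl L) A" for y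
        using s that by (auto simp: least_def Upper_def Lower_def)
      ultimately show ?thesis by (auto simp: greatest_def Lower_def)
    qed
  qed
qed

end

theory Submission
  imports Defs
begin

text \<open>To see that a closure operator \<open>h\<close> generated by prenuclei satisfies
  \<open>h x \<sqinter> y \<sqsubseteq> h (x \<sqinter> y)\<close>, consider the set of all \<open>z\<close> with \<open>z \<sqinter> y \<sqsubseteq> h (x \<sqinter> y)\<close>. It
  contains \<open>x\<close> and is a lower set; it is closed under directed joins because meets
  distribute over them, and under each generator \<open>g\<close> because
  \<open>g z \<sqinter> y \<sqsubseteq> g z \<sqinter> g y = g (z \<sqinter> y) \<sqsubseteq> h (x \<sqinter> y)\<close>. The generators therefore restrict
  to this set, itself a dcpo, and have a common fixed point above \<open>x\<close> in it, so the least
  such fixed point \<open>h x\<close> lies in it. Applying the inequality in both arguments and using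
  idempotence gives \<open>h x \<sqinter> h y \<sqsubseteq> h (x \<sqinter> y)\<close>.\<close>

text \<open>A directed join formed in \<open>L\<close> already lies in \<open>S\<close>, so it stays
  least among the upper bounds that belong to \<open>S\<close>. This makes the construction of
  generated closures available inside \<open>S\<close>.\<close>

lemma (in dcpo) dcpo_restrict_carrier:
  assumes S: "S \<subseteq> carrier L"
    and sup: "\<And>D. \<lbrakk>directed L D; D \<subseteq> S\<rbrakk> \<Longrightarrow> \<Squnion>D \<in> S"
  shows "dcpo (L\<lparr>carrier := S\<rparr>)"
proof -
  interpret S: partial_order "L\<lparr>carrier := S\<rparr>"
    by unfold_locales
      (use S in \<open>auto simp: eq_is_equal subset_iff intro: le_antisym dest: le_trans\<close>)
  show ?thesis
  proof
    fix D assume "directed (L\<lparr>carrier := S\<rparr>) D"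
    then have D: "directed L D" "D \<subseteq> S"
      using S by (auto simp: directed_def)
    have "Upper (L\<lparr>carrier := S\<rparr>) D = Upper L D \<inter> S"
      using D(2) S by (auto simp: Upper_def)
    then have "least (L\<lparr>carrier := S\<rparr>) (\<Squnion>D) (Upper (L\<lparr>carrier := S\<rparr>) D)"
      using directed_sup_least[OF D(1)] sup[OF D] by (auto simp: least_def)
    then show "\<exists>s. least (L\<lparr>carrier := S\<rparr>) s (Upper (L\<lparr>carrier := S\<rparr>) D)" ..
  qed
qed

text \<open>An induction principle for generated closures that needs no transfinite iteration of the
  generators: \<open>S\<close> contains a common fixed point above \<open>x\<close>, and as a lower
  set it contains everything below that point.\<close>

lemma (in dcpo) generated_closure_mem:
  assumes G: "\<forall>g\<in>G. preclosure_map L g"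
    and S: "S \<subseteq> carrier L"
    and lower: "\<And>y z. \<lbrakk>z \<in> S; y \<in> carrier L; y \<sqsubseteq> z\<rbrakk> \<Longrightarrow> y \<in> S"
    and sup: "\<And>D. \<lbrakk>directed L D; D \<subseteq> S\<rbrakk> \<Longrightarrow> \<Squnion>D \<in> S"
    and closed: "\<And>g z. \<lbrakk>g \<in> G; z \<in> S\<rbrakk> \<Longrightarrow> g z \<in> S"
    and x: "x \<in> S"
  shows "generated_closure L G x \<in> S"
proof -
  let ?S = "L\<lparr>carrier := S\<rparr>" and ?h = "generated_closure L G"
  interpret S: dcpo ?S by (rule dcpo_restrict_carrier[OF S sup])
  have pre: "\<forall>g\<in>(\<lambda>g. restrict g S) ` G. preclosure_map ?S g"
  proof clarify
    fix g assume g: "g \<in> G"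
    then have "preclosure_map L g" using G by blast
    note gp = preclosure_mapD[OF this]
    show "preclosure_map ?S (restrict g S)"
      by (rule S.preclosure_mapI) (use S gp(2-4) closed[OF g] in \<open>auto simp: subset_iff\<close>)
  qed
  \<comment> \<open>The value \<open>k x\<close> is the required common fixed point: it lies in
    \<open>S\<close> by construction and is fixed because \<open>k\<close> is idempotent.\<close>
  define k where "k = generated_closure ?S ((\<lambda>g. restrict g S) ` G)"
  have k: "closure_operator ?S k"
    and fix_k: "fps ?S k = {z \<in> S. \<forall>g\<in>G. g z = z}"
    using S.generated_closure[OF pre] by (auto simp: k_def)
  have kp: "preclosure_map ?S k" and kk: "k (k x) = k x"
    using k x by (auto simp: S.closure_operator_iff)
  have kS: "k x \<in> S" and xk: "x \<sqsubseteq> k x"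
    using preclosure_mapD(2,4)[OF kp] x by auto
  have "\<forall>g\<in>G. g (k x) = k x"
    using fix_k kS kk by (auto simp: S.fps_eq)
  then have "k x \<in> fps L ?h"
    using generated_closure(2)[OF G] kS S by auto
  then have hk: "?h (k x) = k x" by (simp add: fps_eq)
  have h: "preclosure_map L ?h"
    using generated_closure(1)[OF G] by (simp add: closure_operator_iff)
  have "?h x \<sqsubseteq> k x"
    using preclosure_mapD(3)[OF h _ _ xk] hk x kS S by auto
  then show ?thesis
    using lower[OF kS] preclosure_mapD(2)[OF h] x S by blast
qed

lemma (in lower_semilattice) meet_mono:
  assumes "a \<in> carrier L" "b \<in> carrier L" "c \<in> carrier L" "d \<in> carrier L"
    and "a \<sqsubseteq> c" "b \<sqsubseteq> d"
  shows "a \<sqinter> b \<sqsubseteq> c \<sqinter> d"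
proof (rule meet_le)
  show "a \<sqinter> b \<sqsubseteq> c"
    by (rule le_trans[OF meet_left]) (use assms in simp_all)
  show "a \<sqinter> b \<sqsubseteq> d"
    by (rule le_trans[OF meet_right]) (use assms in simp_all)
qed (use assms in simp_all)

text \<open>The distributive law only equates two chosen values of \<open>\<Squnion>\<close>. The
  image of \<open>D\<close> under the meet with \<open>y\<close> is itself directed, so the second
  value is a genuine least upper bound.\<close>

lemma (in preframe) inf_directed_sup_le:
  assumes y: "y \<in> carrier L" and c: "c \<in> carrier L" and D: "directed L D"
    and le: "\<And>d. d \<in> D \<Longrightarrow> y \<sqinter> d \<sqsubseteq> c"
  shows "y \<sqinter> \<Squnion>D \<sqsubseteq> c"
proof -
  have Dc: "D \<subseteq> carrier L" using D by (simp add: directed_def)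
  have "directed L ((\<lambda>d. y \<sqinter> d) ` D)"
    unfolding directed_def
  proof (intro conjI ballI)
    fix a b assume "a \<in> (\<lambda>d. y \<sqinter> d) ` D" "b \<in> (\<lambda>d. y \<sqinter> d) ` D"
    then obtain d e where de: "d \<in> D" "e \<in> D" "a = y \<sqinter> d" "b = y \<sqinter> e" by auto
    then obtain f where f: "f \<in> D" "d \<sqsubseteq> f" "e \<sqsubseteq> f"
      using D by (meson directed_def)
    then have "a \<sqsubseteq> y \<sqinter> f" "b \<sqsubseteq> y \<sqinter> f"
      using de y Dc by (auto intro!: meet_mono)
    then show "\<exists>z\<in>(\<lambda>d. y \<sqinter> d) ` D. a \<sqsubseteq> z \<and> b \<sqsubseteq> z" using f by blast
  qed (use D y Dc in \<open>auto simp: directed_def\<close>)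
  then have "least L (\<Squnion>((\<lambda>d. y \<sqinter> d) ` D)) (Upper L ((\<lambda>d. y \<sqinter> d) ` D))"
    by (rule directed_sup_least)
  moreover have "c \<in> Upper L ((\<lambda>d. y \<sqinter> d) ` D)"
    using c le by (auto simp: Upper_def)
  ultimately have "\<Squnion>((\<lambda>d. y \<sqinter> d) ` D) \<sqsubseteq> c" by (rule least_le)
  then show ?thesis using inf_directed_sup[OF y D] by simp
qed

lemma (in preframe) meet_generated_closure_le:
  assumes G: "\<forall>g\<in>G. prenucleus L g" and x: "x \<in> carrier L" and y: "y \<in> carrier L"
  shows "y \<sqinter> generated_closure L G x \<sqsubseteq> generated_closure L G (y \<sqinter> x)"
proof -
  let ?h = "generated_closure L G"
  define c where "c = ?h (y \<sqinter> x)"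
  have pre: "\<forall>g\<in>G. preclosure_map L g" using G by (auto simp: prenucleus_def)
  have h: "closure_operator L ?h" by (rule generated_closure(1)[OF pre])
  then have hp: "preclosure_map L ?h" and c: "c \<in> carrier L" "?h c = c"
    using x y by (auto simp: closure_operator_iff c_def intro: preclosure_mapD(2))
  then have "c \<in> fps L ?h" by (simp add: fps_eq)
  then have gc: "g c = c" if "g \<in> G" for g
    using generated_closure(2)[OF pre] that by auto
  have "?h x \<in> {z \<in> carrier L. y \<sqinter> z \<sqsubseteq> c}"
  proof (rule generated_closure_mem[OF pre])
    fix w z assume z: "z \<in> {z \<in> carrier L. y \<sqinter> z \<sqsubseteq> c}" and w: "w \<in> carrier L" "w \<sqsubseteq> z"
    then have "y \<sqinter> w \<sqsubseteq> y \<sqinter> z" using y by (auto intro!: meet_mono)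
    then show "w \<in> {z \<in> carrier L. y \<sqinter> z \<sqsubseteq> c}"
      using z w y c by (auto intro: le_trans[of _ "y \<sqinter> z"])
  next
    fix D assume D: "directed L D" "D \<subseteq> {z \<in> carrier L. y \<sqinter> z \<sqsubseteq> c}"
    have "\<Squnion>D \<in> carrier L"
      using directed_sup_least[OF D(1)] by (auto simp: least_def Upper_def)
    moreover have "y \<sqinter> \<Squnion>D \<sqsubseteq> c"
      by (rule inf_directed_sup_le[OF y c(1) D(1)]) (use D(2) in auto)
    ultimately show "\<Squnion>D \<in> {z \<in> carrier L. y \<sqinter> z \<sqsubseteq> c}" by simp
  next
    fix g z assume g: "g \<in> G" and z': "z \<in> {z \<in> carrier L. y \<sqinter> z \<sqsubseteq> c}"
    then have z: "z \<in> carrier L" "y \<sqinter> z \<sqsubseteq> c" by auto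
    have "preclosure_map L g" using pre g by blast
    note gp = preclosure_mapD[OF this]
    \<comment> \<open>Since \<open>g\<close> is ascending, \<open>y\<close> may be enlarged to
      \<open>g y\<close>, which lets preservation of meets apply.\<close>
    have "y \<sqinter> g z \<sqsubseteq> g y \<sqinter> g z"
      using y z gp by (auto intro!: meet_mono)
    also have "g y \<sqinter> g z = g (y \<sqinter> z)"
      using G g y z by (auto simp: prenucleus_def preserves_meets_def)
    \<comment> \<open>Monotonicity gives the bound \<open>g c\<close>, and \<open>c\<close> is fixed
      by every generator.\<close>
    also have "g (y \<sqinter> z) \<sqsubseteq> c"
      using gp(3)[of "y \<sqinter> z" c] gc[OF g] y z c by auto
    finally show "g z \<in> {z \<in> carrier L. y \<sqinter> z \<sqsubseteq> c}"
      using gp y z c by auto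
  next
    show "x \<in> {z \<in> carrier L. y \<sqinter> z \<sqsubseteq> c}"
      using preclosure_mapD(4)[OF hp] x y by (simp add: c_def)
  qed auto
  then show ?thesis by (simp add: c_def)
qed

lemma (in preframe) nucleus_generated_closure:
  assumes G: "\<forall>g\<in>G. prenucleus L g"
  shows "nucleus L (generated_closure L G)"
proof -
  let ?h = "generated_closure L G"
  have h: "closure_operator L ?h"
    using generated_closure(1) G by (auto simp: prenucleus_def)
  then have hp: "preclosure_map L ?h"
    and idem: "\<And>x. x \<in> carrier L \<Longrightarrow> ?h (?h x) = ?h x"
    by (auto simp: closure_operator_iff)
  note hD = preclosure_mapD[OF hp]
  have "?h (x \<sqinter> y) = ?h x \<sqinter> ?h y" if x: "x \<in> carrier L" and y: "y \<in> carrier L" for x y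
  proof (rule le_antisym)
    show "?h (x \<sqinter> y) \<sqsubseteq> ?h x \<sqinter> ?h y"
      using x y hD(2) by (intro meet_le hD(3)) (auto simp: meet_left meet_right)
    \<comment> \<open>First \<open>?h\<close> is pulled out of the second argument with
      \<open>?h x\<close> held fixed, then out of the first; idempotence merges the two
      applications.\<close>
    have "?h x \<sqinter> ?h y \<sqsubseteq> ?h (?h x \<sqinter> y)"
      by (rule meet_generated_closure_le[OF G y hD(2)[OF x]])
    also have "?h (?h x \<sqinter> y) \<sqsubseteq> ?h (?h (x \<sqinter> y))"
      using meet_generated_closure_le[OF G x y] x y hD(2)
      by (intro hD(3)) (auto simp: meet_comm)
    finally show "?h x \<sqinter> ?h y \<sqsubseteq> ?h (x \<sqinter> y)"
      using x y hD(2) idem by auto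
  qed (use x y hD(2) in auto)
  then show ?thesis using h by (simp add: nucleus_def preserves_meets_def)
qed

text \<open>Least upper bounds in \<open>Cl L\<close> are unique because the pointwise order is
  antisymmetric, so the chosen join must be the generated closure.\<close>

lemma (in dcpo) Cl_sup_eq_generated_closure:
  assumes "G \<subseteq> carrier (Cl L)"
  shows "\<Squnion>\<^bsub>Cl L\<^esub>G = generated_closure L G"
proof -
  interpret Cl: partial_order "Cl L" by (rule Cl_partial_order)
  note lst = Cl_least_Upper[OF assms]
  have "least (Cl L) (\<Squnion>\<^bsub>Cl L\<^esub>G) (Upper (Cl L) G)"
    unfolding sup_def by (rule someI[where P = "\<lambda>s. least (Cl L) s (Upper (Cl L) G)", OF lst])
  then show ?thesis using lst by (rule Cl.least_unique)
qed

theorem theorem5p1: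
  fixes P (structure)
  assumes "preframe P"
  shows "(\<forall>\<Gamma>. (\<forall>\<gamma>\<in>\<Gamma>. prenucleus P \<gamma>) \<longrightarrow> nucleus P (generated_closure P \<Gamma>)) \<and>
         (\<forall>\<Gamma>. (\<forall>\<gamma>\<in>\<Gamma>. nucleus P \<gamma>) \<longrightarrow> nucleus P (\<Squnion>\<^bsub>Cl P\<^esub>\<Gamma>))"
proof -
  interpret preframe P by fact
  have "nucleus P (\<Squnion>\<^bsub>Cl P\<^esub>\<Gamma>)" if \<Gamma>: "\<forall>\<gamma>\<in>\<Gamma>. nucleus P \<gamma>" for \<Gamma>
  proof -
    have "\<Gamma> \<subseteq> carrier (Cl P)" using \<Gamma> by (auto simp: Cl_def nucleus_def)
    moreover have "\<forall>\<gamma>\<in>\<Gamma>. prenucleus P \<gamma>"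
      using \<Gamma> by (auto simp: nucleus_def prenucleus_def closure_operator_def)
    ultimately show ?thesis
      using Cl_sup_eq_generated_closure nucleus_generated_closure by simp
  qed
  then show ?thesis using nucleus_generated_closure by blast
qed

end
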